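(* Let $p:\mathbb{R}\to\mathbb{R}$ be a non-smooth arbitrary support distribution, and let $\mathcal{F}_p=\{p_{l,s}(x)=\frac1s p(\frac{x-l}{s}) : l,s\in\mathbb{R},\, s>0\}$ be the location-scale family generated by $p$ (a non-smooth location-scale family with arbitrary support), with parameter $\lambda=(\lambda_1,\lambda_2)=(l,s)$. Then the metric tensor of the probability family manifold is $$g_{ij}(l,s)=\frac{1}{s^2}\begin{pmatrix} a^2 & c\\ c & b^2\end{pmatrix},$$ where $$a^2=\mathbb{E}_p\left[\left(\frac{p'(x)}{p(x)}\right)^2\right]\ge 0,\qquad b^2=\mathbb{E}_p\left[\left(1+x\frac{p'(x)}{p(x)}\right)^2\right]\ge 0,\qquad c=\mathbb{E}_p\left[\frac{p'(x)}{p(x)}\left(1+x\frac{p'(x)}{p(x)}\right)\right].$$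
   Context: For a real-valued function $p$ on $\mathbb{R}$, its positive support is $p^+=\{x\in\mathbb{R} : p(x)>0\}$; "arbitrary support" means that $p^+\subseteq\mathbb{R}$ may be a proper subset of $\mathbb{R}$. A function $p:\mathbb{R}\to\mathbb{R}$ is a non-smooth arbitrary support distribution if: (1) $p(x)\ge 0$ for all $x$, and $p$ has arbitrary support; (2) $p^+$ is a measurable set of non-zero measure, and $p$ is Lebesgue integrable on $p^+$ with $\int_{p^+}p(x)\,dx=\int_{-\infty}^{+\infty}p(x)\,dx=1$; (3) instead of smoothness, the derivative $p'(x)$ exists and is finite almost everywhere in the Lebesgue measure. Expectations are taken over the positive support: $\mathbb{E}_q[f(x)]=\int_{q^+}q(x)f(x)\,dx$ for a density $q$. The metric tensor of the manifold of a parametric family $p_\lambda$, $\lambda=(\lambda_1,\lambda_2)$, is the one given by the Fisher information matrix, $$g_{ij}(\lambda)=\mathbb{E}_{p_\lambda}\left[-\partial_i\partial_j\log p_\lambda(x)\right],\qquad \partial_i=\frac{\partial}{\partial\lambda_i}.$$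
   Formalization: The formula is proved in general for E[∂i log p_λ ∂j log p_λ]; for E[-∂i∂j log p_λ] it is also assumed that p is twice differentiable a.e. on p^+ and each ∂i∂j p_λ has integral 0, since the claim fails for the uniform density (g_22=-1/s^2, b^2=1). *)

theory Defs
  imports "HOL-Analysis.Analysis"
begin

definition pos_support :: "(real \<Rightarrow> real) \<Rightarrow> real set"
  where "pos_support p = {x. p x > 0}"

text \<open>``Arbitrary support'' means that the positive support may be any subset of the line, so it
  contributes no clause of its own.\<close>

definition nonsmooth_density :: "(real \<Rightarrow> real) \<Rightarrow> bool"
  where "nonsmooth_density p \<longleftrightarrow>
    (\<forall>x. p x \<ge> 0) \<and>
    pos_support p \<in> sets lebesgue \<and> emeasure lebesgue (pos_support p) \<noteq> 0 \<and>
    set_integrable lebesgue (pos_support p) p \<and>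
    (LINT x:pos_support p|lebesgue. p x) = 1 \<and> (LINT x|lebesgue. p x) = 1 \<and>
    (AE x in lebesgue. p differentiable (at x))"

definition expect :: "(real \<Rightarrow> real) \<Rightarrow> (real \<Rightarrow> real) \<Rightarrow> real"
  where "expect q f = (LINT x:pos_support q|lebesgue. q x * f x)"

definition partial :: "'n::finite \<Rightarrow> (real^'n \<Rightarrow> real) \<Rightarrow> real^'n \<Rightarrow> real"
  where "partial i f v = deriv (\<lambda>t. f (v + t *\<^sub>R axis i 1)) 0"

definition metric_tensor :: "(real^'n::finite \<Rightarrow> real \<Rightarrow> real) \<Rightarrow> real^'n \<Rightarrow> real^'n^'n"
  where "metric_tensor F v =
    (\<chi> i j. expect (F v) (\<lambda>x. - partial i (partial j (\<lambda>u. ln (F u x))) v))"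

definition score_information :: "(real^'n::finite \<Rightarrow> real \<Rightarrow> real) \<Rightarrow> real^'n \<Rightarrow> real^'n^'n"
  where "score_information F v =
    (\<chi> i j. expect (F v) (\<lambda>x. partial i (\<lambda>u. ln (F u x)) v * partial j (\<lambda>u. ln (F u x)) v))"

text \<open>The parameter is \<open>(l, s)\<close>; only \<open>s > 0\<close> is meaningful.\<close>

definition loc_scale :: "(real \<Rightarrow> real) \<Rightarrow> real^2 \<Rightarrow> real \<Rightarrow> real"
  where "loc_scale p v x = (1 / v$2) * p ((x - v$1) / v$2)"

text \<open>An almost everywhere defined first derivative does not suffice for the Hessian form of the
  Fisher information: second derivatives may fail to exist, and even where they exist almost
  everywhere the Hessian and score forms may differ. For the uniform density on \<open>[0,1]\<close> the
  scale entry of the Hessian form is \<open>- 1 / s\<^sup>2\<close> while that of the score form is \<open>1 / s\<^sup>2\<close>; for the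
  Laplace density \<open>exp (- \<bar>x\<bar>) / 2\<close> the location entries are \<open>0\<close> and \<open>1 / s\<^sup>2\<close>. The following two
  conditions are the classical ones that link the forms: existence of the second derivatives, and
  differentiation of \<open>\<integral> F v = 1\<close> twice under the integral sign.\<close>

definition ae_twice_differentiable :: "(real \<Rightarrow> real) \<Rightarrow> bool"
  where "ae_twice_differentiable p \<longleftrightarrow>
    (AE x in lebesgue. x \<in> pos_support p \<longrightarrow>
      (\<forall>\<^sub>F y in nhds x. p differentiable (at y)) \<and> deriv p differentiable (at x))"

definition second_order_regular :: "(real^'n::finite \<Rightarrow> real \<Rightarrow> real) \<Rightarrow> real^'n \<Rightarrow> bool"
  where "second_order_regular F v \<longleftrightarrow>
    (\<forall>i j. set_integrable lebesgue (pos_support (F v)) (\<lambda>x. partial i (partial j (\<lambda>u. F u x)) v) \<and>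
      (LINT x:pos_support (F v)|lebesgue. partial i (partial j (\<lambda>u. F u x)) v) = 0)"

end

theory Submission
  imports Defs
begin

text \<open>With \<open>y = (x - l) / s\<close> and \<open>r = p' / p\<close>, the scores of the family are \<open>- r(y) / s\<close> and
  \<open>- (1 + y r(y)) / s\<close> at almost every point of the support, and the substitution \<open>x = l + s y\<close>
  turns their second moments into expectations under \<open>p\<close>. For the Hessian form,
  \<open>- \<partial>\<^sub>i\<partial>\<^sub>j ln F = \<partial>\<^sub>i ln F \<partial>\<^sub>j ln F - \<partial>\<^sub>i\<partial>\<^sub>j F / F\<close>, and second-order regularity says that the last
  term has expectation 0. The Fisher information need not be finite: since the subtracted term
  is integrable, both sides diverge together and then both carry the junk value 0.\<close>

section \<open>Null sets and completeness of Lebesgue measure\<close>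

text \<open>The preimages of a set under \<open>f\<close> and \<open>g\<close> differ by a subset of
  a null set, and the completed measure makes every such subset measurable.\<close>

lemma lebesgue_measurable_AE_eq:
  fixes f g :: "'a::euclidean_space \<Rightarrow> 'b::topological_space"
  assumes f: "f \<in> borel_measurable lebesgue" and ae: "AE x in lebesgue. f x = g x"
  shows "g \<in> borel_measurable lebesgue"
proof (rule measurableI)
  fix A :: "'b set" assume A: "A \<in> sets borel"
  have "f -` A \<in> sets lebesgue"
    using measurable_sets[OF f A] by simp
  moreover have "AE x in lebesgue. x \<in> f -` A \<longleftrightarrow> x \<in> g -` A"
    using ae by eventually_elim auto
  ultimately show "g -` A \<inter> space lebesgue \<in> sets lebesgue"
    using completion.in_sets_AE[of "f -` A" "g -` A" lborel] by simp
qed simp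

text \<open>Completeness of the measure makes measurability assumptions unnecessary: a non-measurable
  integrand has the junk integral 0, and so has every function that agrees with it almost
  everywhere.\<close>

lemma lebesgue_integral_cong_AE:
  fixes f g :: "'a::euclidean_space \<Rightarrow> 'b::{banach,second_countable_topology}"
  assumes "AE x in lebesgue. f x = g x"
  shows "(LINT x|lebesgue. f x) = (LINT x|lebesgue. g x)"
proof (cases "f \<in> borel_measurable lebesgue")
  case True
  then show ?thesis
    using lebesgue_measurable_AE_eq[OF True assms] assms by (intro integral_cong_AE)
next
  case False
  moreover have "AE x in lebesgue. g x = f x"
    using assms by eventually_elim simp
  ultimately have "g \<notin> borel_measurable lebesgue"
    using lebesgue_measurable_AE_eq[of g f] by blast
  with False show ?thesis
    by (metis borel_measurable_integrable not_integrable_integral_eq)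
qed

text \<open>The exceptional set is carried along by the affine map \<open>t + c * x\<close>, and a
  differentiable map of the line to itself sends negligible sets to negligible sets.\<close>

lemma AE_lebesgue_real_affine:
  fixes c t :: real
  assumes "AE x in lebesgue. P x" "c \<noteq> 0"
  shows "AE x in lebesgue. P ((x - t) / c)"
proof -
  have "{x. \<not> P x} \<in> null_sets lebesgue"
    using assms(1) by (simp add: completion.AE_iff_null_sets)
  then have "negligible {x. \<not> P x}"
    by (simp add: negligible_iff_null_sets)
  then have "(\<lambda>x. t + c * x) ` {x. \<not> P x} \<in> null_sets lebesgue"
    unfolding negligible_iff_null_sets[symmetric]
    by (rule negligible_differentiable_image_negligible[OF order_refl])
       (auto intro!: derivative_intros)
  moreover have "(\<lambda>x. t + c * x) ` {x. \<not> P x} = {x. \<not> P ((x - t) / c)}"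
    using assms(2) by (force simp: image_iff field_simps)
  ultimately show ?thesis
    by (simp add: completion.AE_iff_null_sets)
qed

section \<open>Expectations over the positive support\<close>

text \<open>The indicator of the positive support removes all other points, so identities for
  scores, which divide by the density, have to be checked only where the density is
  positive.\<close>

lemma expect_cong_AE:
  assumes "AE x in lebesgue. q x > 0 \<longrightarrow> f x = g x"
  shows "expect q f = expect q g"
  unfolding expect_def set_lebesgue_integral_def
  by (rule lebesgue_integral_cong_AE)
     (use assms in \<open>eventually_elim; auto simp: pos_support_def indicator_def\<close>)

lemma expect_nonneg:
  assumes "\<And>x. f x \<ge> 0"
  shows "expect q f \<ge> 0"
  unfolding expect_def set_lebesgue_integral_def
  by (rule Bochner_Integration.integral_nonneg)
     (use assms in \<open>auto simp: pos_support_def indicator_def\<close>)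

lemma expect_mult_left: "expect q (\<lambda>x. c * f x) = c * expect q f"
proof -
  have "expect q (\<lambda>x. c * f x) = (LINT x:pos_support q|lebesgue. c * (q x * f x))"
    by (simp add: expect_def mult.left_commute)
  then show ?thesis
    by (simp add: expect_def)
qed

text \<open>Under x = l + s y the Jacobian s cancels the factor 1 / s of the density, and y lies in
  the support of \<open>p\<close> exactly when x lies in the support of the scaled density.\<close>

lemma expect_location_scale:
  fixes l s :: real
  assumes "s > 0"
  shows "expect (\<lambda>x. 1 / s * p ((x - l) / s)) (\<lambda>x. f ((x - l) / s)) = expect p f"
proof -
  have "expect (\<lambda>x. 1 / s * p ((x - l) / s)) (\<lambda>x. f ((x - l) / s))
      = s * (LINT x|lebesgue. indicator (pos_support p) x *\<^sub>R (1 / s * (p x * f x)))"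
    unfolding expect_def set_lebesgue_integral_def
    by (subst lebesgue_integral_real_affine[of s _ l])
       (use assms in \<open>auto simp: pos_support_def indicator_def zero_less_divide_iff
          intro!: Bochner_Integration.integral_cong\<close>)
  also have "\<dots> = s * (1 / s * expect p f)"
    unfolding expect_def set_lebesgue_integral_def
    by (subst integral_mult_right_zero[symmetric])
       (auto simp: mult_ac intro!: Bochner_Integration.integral_cong)
  finally show ?thesis
    using assms by simp
qed

section \<open>Partial derivatives of a logarithm\<close>

lemma partial_eqI:
  assumes "((\<lambda>t. f (v + t *\<^sub>R axis i 1)) has_real_derivative D) (at 0)"
  shows "partial i f v = D"
  unfolding partial_def using assms by (rule DERIV_imp_deriv)

lemma partial_ln:
  assumes "(\<lambda>t. f (v + t *\<^sub>R axis i 1)) differentiable (at 0)" "f v > 0"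
  shows "partial i (\<lambda>u. ln (f u)) v = partial i f v / f v"
proof (rule partial_eqI)
  have "((\<lambda>t. f (v + t *\<^sub>R axis i 1)) has_real_derivative partial i f v) (at 0)"
    using assms(1) unfolding partial_def by (simp add: DERIV_deriv_iff_real_differentiable)
  then show "((\<lambda>t. ln (f (v + t *\<^sub>R axis i 1))) has_real_derivative partial i f v / f v) (at 0)"
    using assms(2) by (auto intro!: derivative_eq_intros)
qed

text \<open>Turns a neighbourhood of parameters into a one-variable neighbourhood of 0, the form in
  which two functions must agree for their derivatives at 0 to coincide.\<close>

lemma eventually_along_axis:
  assumes "\<forall>\<^sub>F u in nhds v. P u"
  shows "\<forall>\<^sub>F t in nhds 0. P (v + t *\<^sub>R axis i (1::real))"
proof -
  have "((\<lambda>t. v + t *\<^sub>R axis i (1::real)) \<longlongrightarrow> v + 0 *\<^sub>R axis i 1) (nhds 0)"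
    by (intro tendsto_intros filterlim_ident)
  with assms show ?thesis
    by (simp add: filterlim_iff)
qed

text \<open>This is the quotient rule for \<open>partial j f u / f u\<close>. That quotient equals
  the first logarithmic partial on a whole neighbourhood of \<open>v\<close>, which permits
  differentiating the equality once more; hence \<open>near\<close> speaks of all nearby
  parameters.\<close>

lemma partial_partial_ln:
  assumes near: "\<forall>\<^sub>F u in nhds v. f u > 0 \<and> (\<lambda>t. f (u + t *\<^sub>R axis j 1)) differentiable (at 0)"
    and i: "(\<lambda>t. f (v + t *\<^sub>R axis i 1)) differentiable (at 0)"
    and ij: "(\<lambda>t. partial j f (v + t *\<^sub>R axis i 1)) differentiable (at 0)"
  shows "partial i (partial j (\<lambda>u. ln (f u))) v
    = partial i (partial j f) v / f v
      - partial i (\<lambda>u. ln (f u)) v * partial j (\<lambda>u. ln (f u)) v"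
proof -
  have pos: "f v > 0" and j: "(\<lambda>t. f (v + t *\<^sub>R axis j 1)) differentiable (at 0)"
    using eventually_nhds_x_imp_x[OF near] by auto
  have Di: "((\<lambda>t. f (v + t *\<^sub>R axis i 1)) has_real_derivative partial i f v) (at 0)"
    using i unfolding partial_def by (simp add: DERIV_deriv_iff_real_differentiable)
  have Dij: "((\<lambda>t. partial j f (v + t *\<^sub>R axis i 1)) has_real_derivative
      partial i (partial j f) v) (at 0)"
    using ij unfolding partial_def[of i] by (simp add: DERIV_deriv_iff_real_differentiable)
  have "\<forall>\<^sub>F u in nhds v. partial j (\<lambda>u. ln (f u)) u = partial j f u / f u"
    using near by eventually_elim (auto intro: partial_ln)
  note ev = eventually_along_axis[OF this, of i]
  have "((\<lambda>t. partial j f (v + t *\<^sub>R axis i 1) / f (v + t *\<^sub>R axis i 1)) has_real_derivative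
      (partial i (partial j f) v * f v - partial j f v * partial i f v) / (f v * f v)) (at 0)"
    using DERIV_divide[OF Dij Di] pos by simp
  then have "partial i (partial j (\<lambda>u. ln (f u))) v
      = (partial i (partial j f) v * f v - partial j f v * partial i f v) / (f v * f v)"
    by (intro partial_eqI) (subst DERIV_cong_ev[OF refl ev refl])
  then show ?thesis
    using pos by (simp add: partial_ln[OF i] partial_ln[OF j] diff_divide_distrib)
qed

section \<open>From the Hessian form to the score form\<close>

text \<open>If \<open>f\<close> is not integrable, neither is \<open>f - h\<close>, since adding
  \<open>h\<close> back would recover \<open>f\<close>; both integrals then have the default value
  0. This covers infinite Fisher information.\<close>

lemma integral_diff_null:
  fixes f h :: "'a \<Rightarrow> 'b::{banach,second_countable_topology}"
  assumes "integrable M h" "(LINT x|M. h x) = 0"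
  shows "(LINT x|M. f x - h x) = (LINT x|M. f x)"
proof (cases "integrable M f")
  case True
  then show ?thesis
    using assms by simp
next
  case False
  then have "\<not> integrable M (\<lambda>x. f x - h x)"
    using Bochner_Integration.integrable_add[OF _ assms(1), of "\<lambda>x. f x - h x"] by auto
  with False show ?thesis
    by (simp add: not_integrable_integral_eq)
qed

text \<open>The two forms differ, entry by entry, by the integral of a second partial of the density
  over its support, which \<open>reg\<close> makes 0. The pointwise conditions ask that almost every
  point of the support stay in it under small changes of the parameter, so that the logarithm can be
  differentiated twice.\<close>

theorem metric_tensor_eq_score_information:
  assumes reg: "second_order_regular F v"
    and near: "\<And>j. AE x in lebesgue. F v x > 0 \<longrightarrow> (\<forall>\<^sub>F u in nhds v.
      F u x > 0 \<and> (\<lambda>t. F (u + t *\<^sub>R axis j 1) x) differentiable (at 0))"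
    and second: "\<And>i j. AE x in lebesgue. F v x > 0 \<longrightarrow>
      (\<lambda>t. partial j (\<lambda>u. F u x) (v + t *\<^sub>R axis i 1)) differentiable (at 0)"
  shows "metric_tensor F v = score_information F v"
proof -
  have "expect (F v) (\<lambda>x. - partial i (partial j (\<lambda>u. ln (F u x))) v)
      = expect (F v) (\<lambda>x. partial i (\<lambda>u. ln (F u x)) v * partial j (\<lambda>u. ln (F u x)) v)" for i j
  proof -
    define S where "S = pos_support (F v)"
    define H where "H x = partial i (partial j (\<lambda>u. F u x)) v" for x
    define I where "I x = partial i (\<lambda>u. ln (F u x)) v * partial j (\<lambda>u. ln (F u x)) v" for x
    have H: "integrable lebesgue (\<lambda>x. indicator S x *\<^sub>R H x)"
      "(LINT x|lebesgue. indicator S x *\<^sub>R H x) = 0"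
      using reg unfolding second_order_regular_def set_integrable_def set_lebesgue_integral_def
        S_def H_def by blast+
    have "expect (F v) (\<lambda>x. - partial i (partial j (\<lambda>u. ln (F u x))) v)
        = expect (F v) (\<lambda>x. I x - H x / F v x)"
    proof (rule expect_cong_AE)
      show "AE x in lebesgue. F v x > 0 \<longrightarrow>
          - partial i (partial j (\<lambda>u. ln (F u x))) v = I x - H x / F v x"
        using near[of i] near[of j] second[of j i]
      proof eventually_elim
        case (elim x)
        show ?case
        proof
          assume pos: "F v x > 0"
          have "(\<lambda>t. F (v + t *\<^sub>R axis i 1) x) differentiable (at 0)"
            using eventually_nhds_x_imp_x[where x = v] elim(1) pos by blast
          then show "- partial i (partial j (\<lambda>u. ln (F u x))) v = I x - H x / F v x"
            using elim pos unfolding I_def H_def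
            by (subst partial_partial_ln) auto
        qed
      qed
    qed
    \<comment> \<open>The weight \<open>F v x\<close> cancels the denominator on the support; off
      the support the indicator makes both terms 0.\<close>
    also have "\<dots> = (LINT x|lebesgue. indicator S x *\<^sub>R (F v x * I x) - indicator S x *\<^sub>R H x)"
      unfolding expect_def set_lebesgue_integral_def S_def
      by (intro Bochner_Integration.integral_cong)
         (auto simp: indicator_def pos_support_def field_simps)
    also have "\<dots> = expect (F v) I"
      unfolding integral_diff_null[OF H] by (simp add: expect_def set_lebesgue_integral_def S_def)
    finally show ?thesis
      unfolding I_def .
  qed
  then show ?thesis
    by (simp add: metric_tensor_def score_information_def)
qed

section \<open>Derivatives of location-scale densities\<close>

text \<open>With y = (x - l) / s, the derivatives of y in l and s are -1 / s and -y / s; the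
  prefactor 1 / s supplies the second power of s. The additional term \<open>p\<close> at y in the
  scale direction comes from differentiating that prefactor.\<close>

lemma loc_scale_has_derivative:
  fixes v :: "real^2"
  assumes "v$2 > 0" "p differentiable (at ((x - v$1) / v$2))"
  shows "((\<lambda>t. loc_scale p (v + t *\<^sub>R axis 1 1) x) has_real_derivative
      - deriv p ((x - v$1) / v$2) / (v$2)\<^sup>2) (at 0)"
    and "((\<lambda>t. loc_scale p (v + t *\<^sub>R axis 2 1) x) has_real_derivative
      - (p ((x - v$1) / v$2) + (x - v$1) / v$2 * deriv p ((x - v$1) / v$2)) / (v$2)\<^sup>2) (at 0)"
proof -
  have D: "(p has_real_derivative deriv p ((x - v$1) / v$2)) (at ((x - v$1) / v$2))"
    using assms(2) by (simp add: DERIV_deriv_iff_real_differentiable)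
  have "((\<lambda>t. (x - (v$1 + t)) / v$2) has_real_derivative - 1 / v$2) (at 0)"
    using assms(1) by (auto intro!: derivative_eq_intros)
  from DERIV_chain2[OF _ this, of p] D
  have "((\<lambda>t. p ((x - (v$1 + t)) / v$2)) has_real_derivative
      deriv p ((x - v$1) / v$2) * (- 1 / v$2)) (at 0)"
    by simp
  from DERIV_cmult[OF this, of "1 / v$2"]
  show "((\<lambda>t. loc_scale p (v + t *\<^sub>R axis 1 1) x) has_real_derivative
      - deriv p ((x - v$1) / v$2) / (v$2)\<^sup>2) (at 0)"
    by (simp add: loc_scale_def axis_def power2_eq_square)
  have E: "((\<lambda>t. (x - v$1) / (v$2 + t)) has_real_derivative - (x - v$1) / (v$2)\<^sup>2) (at 0)"
    using assms(1) by (auto intro!: derivative_eq_intros simp: power2_eq_square)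
  from DERIV_chain2[OF _ E, of p] D
  have P: "((\<lambda>t. p ((x - v$1) / (v$2 + t))) has_real_derivative
      deriv p ((x - v$1) / v$2) * (- (x - v$1) / (v$2)\<^sup>2)) (at 0)"
    by simp
  have "((\<lambda>t. 1 / (v$2 + t)) has_real_derivative - 1 / (v$2)\<^sup>2) (at 0)"
    using assms(1) by (auto intro!: derivative_eq_intros simp: power2_eq_square)
  from DERIV_mult[OF this P]
  have "((\<lambda>t. 1 / (v$2 + t) * p ((x - v$1) / (v$2 + t))) has_real_derivative
      - (p ((x - v$1) / v$2) + (x - v$1) / v$2 * deriv p ((x - v$1) / v$2)) / (v$2)\<^sup>2) (at 0)"
    by (rule DERIV_cong) (use assms(1) in \<open>simp add: power2_eq_square field_simps\<close>)
  then show "((\<lambda>t. loc_scale p (v + t *\<^sub>R axis 2 1) x) has_real_derivative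
      - (p ((x - v$1) / v$2) + (x - v$1) / v$2 * deriv p ((x - v$1) / v$2)) / (v$2)\<^sup>2) (at 0)"
    by (simp add: loc_scale_def axis_def)
qed

lemma loc_scale_differentiable:
  fixes v :: "real^2"
  assumes "v$2 > 0" "p differentiable (at ((x - v$1) / v$2))"
  shows "(\<lambda>t. loc_scale p (v + t *\<^sub>R axis j 1) x) differentiable (at 0)"
  using exhaust_2[of j] loc_scale_has_derivative[OF assms] real_differentiable_def by metis

lemmas partial_loc_scale = loc_scale_has_derivative[THEN partial_eqI]

lemma filterlim_standardize:
  fixes v :: "real^2"
  assumes "v$2 \<noteq> 0"
  shows "filterlim (\<lambda>u. (x - u$1) / u$2) (nhds ((x - v$1) / v$2)) (nhds v)"
  using assms by (intro tendsto_intros filterlim_ident) auto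

text \<open>Differentiability at y gives continuity there, so positivity of \<open>p\<close> spreads
  to a neighbourhood of y. Since (x - l) / s is continuous in (l, s) for s > 0, this neighbourhood
  pulls back to one of parameters.\<close>

lemma loc_scale_near:
  fixes v :: "real^2"
  assumes v: "v$2 > 0" and pos: "loc_scale p v x > 0"
    and diff: "\<forall>\<^sub>F y in nhds ((x - v$1) / v$2). p differentiable (at y)"
  shows "\<forall>\<^sub>F u in nhds v. u$2 > 0 \<and> loc_scale p u x > 0 \<and> p differentiable (at ((x - u$1) / u$2))"
proof -
  have "continuous (at ((x - v$1) / v$2)) p"
    using eventually_nhds_x_imp_x[OF diff] differentiable_imp_continuous_within by blast
  moreover have "p ((x - v$1) / v$2) > 0"
    using pos v by (simp add: loc_scale_def zero_less_divide_iff)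
  ultimately have "\<forall>\<^sub>F y in nhds ((x - v$1) / v$2). p y > 0"
    by (auto simp: continuous_within tendsto_at_iff_tendsto_nhds dest: order_tendstoD)
  then have "\<forall>\<^sub>F y in nhds ((x - v$1) / v$2). p y > 0 \<and> p differentiable (at y)"
    using diff by (rule eventually_conj)
  moreover have "filterlim (\<lambda>u. (x - u$1) / u$2) (nhds ((x - v$1) / v$2)) (nhds v)"
    using v by (intro filterlim_standardize) simp
  ultimately have "\<forall>\<^sub>F u in nhds v. p ((x - u$1) / u$2) > 0 \<and> p differentiable (at ((x - u$1) / u$2))"
    by (rule eventually_compose_filterlim)
  moreover have "((\<lambda>u. u$2) \<longlongrightarrow> v$2) (nhds v)"
    by (intro tendsto_intros filterlim_ident)
  then have "\<forall>\<^sub>F u in nhds v. u$2 > 0"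
    using v by (rule order_tendstoD)
  ultimately show ?thesis
    by eventually_elim (auto simp: loc_scale_def)
qed

lemma partial_loc_scale_differentiable:
  fixes v :: "real^2"
  assumes v: "v$2 > 0" and pos: "loc_scale p v x > 0"
    and diff: "\<forall>\<^sub>F y in nhds ((x - v$1) / v$2). p differentiable (at y)"
    and diff2: "deriv p differentiable (at ((x - v$1) / v$2))"
  shows "(\<lambda>t. partial j (\<lambda>u. loc_scale p u x) (v + t *\<^sub>R axis i 1)) differentiable (at 0)"
proof -
  define L where "L t = v + t *\<^sub>R axis i (1::real)" for t
  define Y where "Y t = (x - L t $ 1) / L t $ 2" for t
  have [simp]: "L 0 = v"
    by (simp add: L_def)
  have diffL: "(\<lambda>t. L t $ k) differentiable (at 0)" for k
    unfolding L_def by (simp)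
  have diffY: "Y differentiable (at 0)"
    unfolding Y_def using v diffL by (intro derivative_intros) auto
  have p: "(\<lambda>t. p (Y t)) differentiable (at 0)"
    using differentiable_chain_at[OF diffY, of p] eventually_nhds_x_imp_x[OF diff]
    by (simp add: Y_def o_def)
  have p': "(\<lambda>t. deriv p (Y t)) differentiable (at 0)"
    using differentiable_chain_at[OF diffY, of "deriv p"] diff2
    by (simp add: Y_def o_def)
  \<comment> \<open>The closed form of the first partial along the line \<open>L\<close>: the
    location derivative for \<open>j = 1\<close>, the scale derivative otherwise. It involves only
    \<open>p\<close>, \<open>deriv p\<close> and rational functions of \<open>t\<close>, so its
    differentiability follows from the calculus rules, and agreement near 0 transfers it to the
    partial itself.\<close>
  define D where "D t = (if j = 1 then - deriv p (Y t) / (L t $ 2)\<^sup>2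
    else - (p (Y t) + Y t * deriv p (Y t)) / (L t $ 2)\<^sup>2)" for t
  have "D differentiable (at 0)"
    unfolding D_def using v p p' diffY diffL by (cases "j = 1") (auto intro!: derivative_intros)
  moreover have "\<forall>\<^sub>F t in nhds 0. partial j (\<lambda>u. loc_scale p u x) (L t) = D t"
    using eventually_along_axis[OF loc_scale_near[OF v pos diff], of i]
  proof eventually_elim
    case (elim t)
    then show ?case
      using exhaust_2[of j] unfolding D_def Y_def L_def by (auto simp: partial_loc_scale)
  qed
  ultimately show ?thesis
    unfolding L_def[symmetric] real_differentiable_def by (simp add: DERIV_cong_ev)
qed

section \<open>Scores and metric of the location-scale family\<close>

text \<open>Both partials carry 1 / s^2, and division by the density p(y) / s cancels one power of
  s.\<close>

lemma score_loc_scale: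
  fixes l s :: real
  assumes "s > 0" "p differentiable (at ((x - l) / s))" "p ((x - l) / s) > 0"
  defines "r \<equiv> \<lambda>y. deriv p y / p y"
  shows "partial 1 (\<lambda>u. ln (loc_scale p u x)) (vector [l, s]) = - (1 / s) * r ((x - l) / s)"
    and "partial 2 (\<lambda>u. ln (loc_scale p u x)) (vector [l, s])
      = - (1 / s) * (1 + (x - l) / s * r ((x - l) / s))"
proof -
  let ?v = "vector [l, s] :: real^2"
  have "?v$2 > 0" "p differentiable (at ((x - ?v$1) / ?v$2))"
    using assms by simp_all
  note diff = this
  have F: "loc_scale p ?v x = p ((x - l) / s) / s"
    by (simp add: loc_scale_def)
  then have "loc_scale p ?v x > 0"
    using assms by simp
  note partial_ln[OF loc_scale_differentiable[OF diff] this]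
  then show "partial 1 (\<lambda>u. ln (loc_scale p u x)) ?v = - (1 / s) * r ((x - l) / s)"
    and "partial 2 (\<lambda>u. ln (loc_scale p u x)) ?v
      = - (1 / s) * (1 + (x - l) / s * r ((x - l) / s))"
    using assms(1,3) unfolding partial_loc_scale[OF diff] r_def
    by (simp_all add: partial_loc_scale[OF diff] F power2_eq_square field_simps)
qed

text \<open>Each score is -1 / s times a function of y alone. In a product of two scores the signs
  cancel and 1 / s^2 comes out; the remaining expectation is moved to \<open>p\<close> by the
  substitution.\<close>

lemma score_information_loc_scale:
  fixes l s :: real
  assumes "s > 0" and diff: "AE x in lebesgue. p differentiable (at x)"
  defines "r \<equiv> \<lambda>y. deriv p y / p y"
  shows "score_information (loc_scale p) (vector [l, s]) = (1 / s\<^sup>2) *\<^sub>R (vector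
    [vector [expect p (\<lambda>y. (r y)\<^sup>2), expect p (\<lambda>y. r y * (1 + y * r y))],
     vector [expect p (\<lambda>y. r y * (1 + y * r y)), expect p (\<lambda>y. (1 + y * r y)\<^sup>2)]] :: real^2^2)"
proof -
  let ?v = "vector [l, s] :: real^2" and ?Y = "\<lambda>x. (x - l) / s"
  \<comment> \<open>The scores stripped of the factor -1 / s, indexed by parameter so that one
    computation serves all four entries.\<close>
  define A where "A j y = (if j = (1::2) then r y else 1 + y * r y)" for j y
  have F: "loc_scale p ?v = (\<lambda>x. 1 / s * p (?Y x))"
    by (simp add: loc_scale_def fun_eq_iff)
  have AE: "AE x in lebesgue. p differentiable (at (?Y x))"
    using AE_lebesgue_real_affine[OF diff] assms(1) by simp
  have "expect (loc_scale p ?v) (\<lambda>x. partial i (\<lambda>u. ln (loc_scale p u x)) ?v *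
        partial j (\<lambda>u. ln (loc_scale p u x)) ?v)
      = 1 / s\<^sup>2 * expect p (\<lambda>y. A i y * A j y)" for i j
  proof -
    have "AE x in lebesgue. loc_scale p ?v x > 0 \<longrightarrow>
        partial i (\<lambda>u. ln (loc_scale p u x)) ?v * partial j (\<lambda>u. ln (loc_scale p u x)) ?v
        = 1 / s\<^sup>2 * (A i (?Y x) * A j (?Y x))"
      using AE
    proof eventually_elim
      case (elim x)
      have "partial k (\<lambda>u. ln (loc_scale p u x)) ?v = - (1 / s) * A k (?Y x)" if "p (?Y x) > 0" for k
        using score_loc_scale[OF assms(1) elim that] exhaust_2[of k]
        by (auto simp: A_def r_def)
      then show ?case
        using assms(1) by (simp add: F zero_less_divide_iff power2_eq_square)
    qed
    then have "expect (loc_scale p ?v) (\<lambda>x. partial i (\<lambda>u. ln (loc_scale p u x)) ?v *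
        partial j (\<lambda>u. ln (loc_scale p u x)) ?v)
      = expect (loc_scale p ?v) (\<lambda>x. 1 / s\<^sup>2 * (A i (?Y x) * A j (?Y x)))"
      by (rule expect_cong_AE)
    also have "\<dots> = expect p (\<lambda>y. 1 / s\<^sup>2 * (A i y * A j y))"
      unfolding F by (rule expect_location_scale[OF assms(1)])
    finally show ?thesis
      unfolding expect_mult_left .
  qed
  then show ?thesis
    by (simp add: score_information_def vec_eq_iff forall_2 A_def power2_eq_square mult.commute)
qed

text \<open>As s > 0, the density at x is positive exactly when y lies in the support of
  \<open>p\<close>, so twice differentiability of \<open>p\<close> at almost every y of its support
  becomes the pointwise conditions at almost every x.\<close>

lemma metric_tensor_loc_scale:
  fixes l s :: real
  assumes "s > 0" and twice: "ae_twice_differentiable p"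
    and reg: "second_order_regular (loc_scale p) (vector [l, s])"
  shows "metric_tensor (loc_scale p) (vector [l, s]) = score_information (loc_scale p) (vector [l, s])"
proof (rule metric_tensor_eq_score_information[OF reg])
  let ?v = "vector [l, s] :: real^2"
  have v: "?v$2 > 0"
    using assms(1) by simp
  have AE: "AE x in lebesgue. loc_scale p ?v x > 0 \<longrightarrow>
      (\<forall>\<^sub>F y in nhds ((x - ?v$1) / ?v$2). p differentiable (at y)) \<and>
      deriv p differentiable (at ((x - ?v$1) / ?v$2))"
    using AE_lebesgue_real_affine[OF twice[unfolded ae_twice_differentiable_def], of s l] assms(1)
    by (simp add: pos_support_def loc_scale_def zero_less_divide_iff)
  fix i j :: 2
  show "AE x in lebesgue. loc_scale p ?v x > 0 \<longrightarrow> (\<forall>\<^sub>F u in nhds ?v. loc_scale p u x > 0 \<and>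
      (\<lambda>t. loc_scale p (u + t *\<^sub>R axis j 1) x) differentiable (at 0))"
    using AE
  proof eventually_elim
    case (elim x)
    show ?case
    proof
      assume pos: "loc_scale p ?v x > 0"
      with elim have "\<forall>\<^sub>F y in nhds ((x - ?v$1) / ?v$2). p differentiable (at y)"
        by blast
      from loc_scale_near[OF v pos this]
      show "\<forall>\<^sub>F u in nhds ?v. loc_scale p u x > 0 \<and>
          (\<lambda>t. loc_scale p (u + t *\<^sub>R axis j 1) x) differentiable (at 0)"
        by eventually_elim (auto intro: loc_scale_differentiable)
    qed
  qed
  show "AE x in lebesgue. loc_scale p ?v x > 0 \<longrightarrow>
      (\<lambda>t. partial j (\<lambda>u. loc_scale p u x) (?v + t *\<^sub>R axis i 1)) differentiable (at 0)"
    using AE by eventually_elim (blast intro: partial_loc_scale_differentiable[OF v])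
qed

text \<open>The matrix is asserted for both forms of the Fisher information because they can differ:
  the score form rests on the almost everywhere existing first derivative, and the two regularity
  conditions carry the result over to the Hessian form. Nonnegativity comes from the squares, and a
  divergent expectation has the value 0.\<close>

theorem theorem2p2:
  fixes p :: "real \<Rightarrow> real" and l s :: real
  assumes "nonsmooth_density p" and "s > 0"
  shows "let a2 = expect p (\<lambda>x. (deriv p x / p x)\<^sup>2);
             b2 = expect p (\<lambda>x. (1 + x * (deriv p x / p x))\<^sup>2);
             c = expect p (\<lambda>x. (deriv p x / p x) * (1 + x * (deriv p x / p x)));
             G = (1 / s\<^sup>2) *\<^sub>R (vector [vector [a2, c], vector [c, b2]] :: real^2^2)
         in a2 \<ge> 0 \<and> b2 \<ge> 0 \<and>
            score_information (loc_scale p) (vector [l, s]) = G \<and>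
            (ae_twice_differentiable p \<and> second_order_regular (loc_scale p) (vector [l, s]) \<longrightarrow>
               metric_tensor (loc_scale p) (vector [l, s]) = G)"
proof -
  have diff: "AE x in lebesgue. p differentiable (at x)"
    using assms(1) by (simp add: nonsmooth_density_def)
  show ?thesis
    unfolding Let_def
    using score_information_loc_scale[OF assms(2) diff] metric_tensor_loc_scale[OF assms(2)]
    by (simp add: expect_nonneg)
qed

end
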